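(* Let $\mathbb{K}$ be a superalgebra of type $D_t(\alpha,\beta,\gamma)$ over a field $\mathbb{F}$. Then: (1) if $\mathbb{K}=D_t$, then $Der(\mathbb{K})_{\bar 0}\cong sl_2$, and the even derivations $d$ act by $$e_1d=0,\quad e_2d=0,\quad xd=\gamma_1x+\gamma_2y,\quad yd=\gamma_3x-\gamma_1y,\qquad \text{where } \gamma_1,\gamma_2,\gamma_3\in\mathbb{F};$$ $Der(\mathbb{K})_{\bar 1}$ is $2$-dimensional, and the odd derivations $d$ act by $$e_1d=\gamma_1x+\gamma_2y,\quad e_2d=-(\gamma_1x+\gamma_2y),\quad xd=2(-\gamma_2e_1+\gamma_2te_2),\quad yd=2(\gamma_1e_1-\gamma_1te_2),\qquad \text{where } \gamma_1,\gamma_2\in\mathbb{F};$$ (2) if $\mathbb{K}=D_t(\alpha)$, $\alpha\neq\frac12$, then $Der(\mathbb{K})$ is a one-dimensional Lie algebra, and the even derivations $d$ act by $$e_1d=0,\quad e_2d=0,\quad xd=\gamma x,\quad yd=-\gamma y,\qquad \text{where } \gamma\in\mathbb{F};$$ (3) if $\mathbb{K}=D_t^{1/2}$, then $Der(\mathbb{K})$ is a one-dimensional Lie algebra, and the even derivations $d$ act by $$e_1d=0,\quad e_2d=0,\quad xd=0,\quad yd=\gamma y,\qquad \text{where } \gamma\in\mathbb{F}.$$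
   Context: For $\alpha,\beta,\gamma,t\in\mathbb{F}$, $D_t(\alpha,\beta,\gamma)$ is the superalgebra with even part $\langle e_1,e_2\rangle$, odd part $\langle x,y\rangle$ (so $e_1,e_2,x,y$ is a basis) and multiplication $e_1^2=e_1$, $e_2^2=e_2$, $e_1e_2=e_2e_1=0$, $e_1x=\alpha x+\beta y$, $e_1y=\gamma x+(1-\alpha)y$, $e_2x=(1-\alpha)x-\beta y$, $e_2y=-\gamma x+\alpha y$, $xe_1=(1-\alpha)x-\beta y$, $xe_2=\alpha x+\beta y$, $ye_1=-\gamma x+\alpha y$, $ye_2=\gamma x+(1-\alpha)y$, $x^2=-2\beta(e_1-te_2)$, $xy=2(\alpha e_1+(1-\alpha)te_2)$, $yx=-2((1-\alpha)e_1+\alpha te_2)$, $y^2=2\gamma(e_1-te_2)$. Notation: $D_t(\alpha)=D_t(\alpha,0,0)$, $D_t=D_t(\frac12,0,0)$, $D_t^{1/2}=D_t(\frac12,\frac12,0)$. Linear maps are written on the right. A homogeneous (even or odd) linear map $d$ is a derivation if $(ab)d=(-1)^{p(d)p(b)}(ad)b+a(bd)$ for all homogeneous $a,b$, where $p$ denotes parity. $Der(\mathbb{K})=Der(\mathbb{K})_{\bar0}\oplus Der(\mathbb{K})_{\bar1}$ is the Lie superalgebra spanned by the even and odd derivations. In items (1)-(3) the symbols $\gamma,\gamma_1,\gamma_2,\gamma_3$ are free parameters describing the derivations.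
   Formalization: Characteristic is not 2 (1/2 is used); in (2) and (3) "Der(K) is a one-dimensional Lie algebra" is claimed only for t ≠ -1, and in (3) also only for characteristic not 3; in (3) the even derivations are xd = γy, yd = 0 instead of xd = 0, yd = γy. The original fails otherwise. *)

theory Defs
  imports "HOL-Analysis.Analysis" "HOL-Library.Function_Algebras" "HOL-Library.Z2"
begin

section \<open>Lie algebras inside an ambient vector space\<close>

definition lie_algebra_on ::
  "('f::field \<Rightarrow> 'v::ab_group_add \<Rightarrow> 'v) \<Rightarrow> ('v \<Rightarrow> 'v \<Rightarrow> 'v) \<Rightarrow> 'v set \<Rightarrow> bool" where
  "lie_algebra_on s br L \<longleftrightarrow>
     vector_space s \<and> module.subspace s L \<and>
     (\<forall>a\<in>L. \<forall>b\<in>L. br a b \<in> L) \<and>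
     (\<forall>a\<in>L. \<forall>b\<in>L. \<forall>c\<in>L. br (a + b) c = br a c + br b c \<and> br a (b + c) = br a b + br a c) \<and>
     (\<forall>k. \<forall>a\<in>L. \<forall>b\<in>L. br (s k a) b = s k (br a b) \<and> br a (s k b) = s k (br a b)) \<and>
     (\<forall>a\<in>L. br a a = 0) \<and>
     (\<forall>a\<in>L. \<forall>b\<in>L. \<forall>c\<in>L. br (br a b) c + br (br b c) a + br (br c a) b = 0)"

definition lie_isomorphic ::
  "('f::field \<Rightarrow> 'v::ab_group_add \<Rightarrow> 'v) \<Rightarrow> ('v \<Rightarrow> 'v \<Rightarrow> 'v) \<Rightarrow> 'v set \<Rightarrow>
   ('f \<Rightarrow> 'w::ab_group_add \<Rightarrow> 'w) \<Rightarrow> ('w \<Rightarrow> 'w \<Rightarrow> 'w) \<Rightarrow> 'w set \<Rightarrow> bool" where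
  "lie_isomorphic s br L s' br' L' \<longleftrightarrow>
     lie_algebra_on s br L \<and> lie_algebra_on s' br' L' \<and>
     (\<exists>\<phi>. bij_betw \<phi> L L' \<and>
          (\<forall>a\<in>L. \<forall>b\<in>L. \<phi> (a + b) = \<phi> a + \<phi> b) \<and>
          (\<forall>k. \<forall>a\<in>L. \<phi> (s k a) = s' k (\<phi> a)) \<and>
          (\<forall>a\<in>L. \<forall>b\<in>L. \<phi> (br a b) = br' (\<phi> a) (\<phi> b)))"

definition mat_scale :: "'f::field \<Rightarrow> 'f^'n^'m \<Rightarrow> 'f^'n^'m" where
  "mat_scale k A = (\<chi> i j. k * A $ i $ j)"

definition mat_bracket :: "'f::field^'n^'n \<Rightarrow> 'f^'n^'n \<Rightarrow> 'f^'n^'n" where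
  "mat_bracket A B = A ** B - B ** A"

definition sl2 :: "('f::field^2^2) set" where
  "sl2 = {A. trace A = 0}"

section \<open>Derivations of superalgebras\<close>

text \<open>A superalgebra on \<open>'f^'n\<close> is given by its product and the family of its homogeneous
  components, indexed by \<^typ>\<open>bit\<close>, the integers modulo 2.\<close>

definition parity_sign :: "bit \<Rightarrow> bit \<Rightarrow> 'f::field" where
  "parity_sign p q = (if p * q = 1 then - 1 else 1)"

text \<open>The image of \<open>v\<close> under the right-acting map \<open>d\<close> is written \<open>d v\<close> here.
  The degree condition makes \<open>d\<close> homogeneous of parity \<open>p\<close>.\<close>

definition is_derivation ::
  "('f::field^'n \<Rightarrow> 'f^'n \<Rightarrow> 'f^'n) \<Rightarrow> (bit \<Rightarrow> ('f^'n) set) \<Rightarrow> bit \<Rightarrow> ('f^'n \<Rightarrow> 'f^'n) \<Rightarrow> bool" where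
  "is_derivation m C p d \<longleftrightarrow>
     Vector_Spaces.linear (*s) (*s) d \<and>
     (\<forall>q. \<forall>a\<in>C q. d a \<in> C (q + p)) \<and>
     (\<forall>q r. \<forall>a\<in>C q. \<forall>b\<in>C r. d (m a b) = parity_sign p r *s m (d a) b + m a (d b))"

definition map_scale :: "'f::field \<Rightarrow> ('f^'n \<Rightarrow> 'f^'n) \<Rightarrow> ('f^'n \<Rightarrow> 'f^'n)" where
  "map_scale k d = (\<lambda>v. k *s d v)"

global_interpretation map_vs: vector_space map_scale
  defines map_span = map_vs.span and map_dim = map_vs.dim
  by unfold_locales (auto simp: map_scale_def fun_eq_iff vec.scale_right_distrib vec.scale_left_distrib)

definition Der_part ::
  "('f::field^'n \<Rightarrow> 'f^'n \<Rightarrow> 'f^'n) \<Rightarrow> (bit \<Rightarrow> ('f^'n) set) \<Rightarrow> bit \<Rightarrow> ('f^'n \<Rightarrow> 'f^'n) set" where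
  "Der_part m C p = {d. is_derivation m C p d}"

definition Der ::
  "('f::field^'n \<Rightarrow> 'f^'n \<Rightarrow> 'f^'n) \<Rightarrow> (bit \<Rightarrow> ('f^'n) set) \<Rightarrow> ('f^'n \<Rightarrow> 'f^'n) set" where
  "Der m C = map_span (Der_part m C 0 \<union> Der_part m C 1)"

text \<open>Maps act on the right, so the product \<open>d d'\<close> applies \<open>d\<close> first. On even derivations the
  superbracket is this commutator.\<close>

definition commutator :: "('f::field^'n \<Rightarrow> 'f^'n) \<Rightarrow> ('f^'n \<Rightarrow> 'f^'n) \<Rightarrow> ('f^'n \<Rightarrow> 'f^'n)" where
  "commutator d d' = (\<lambda>v. d' (d v) - d (d' v))"

text \<open>A Lie superalgebra is a Lie algebra when its odd part vanishes.\<close>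

definition Der_one_dimensional_lie_algebra ::
  "('f::field^'n \<Rightarrow> 'f^'n \<Rightarrow> 'f^'n) \<Rightarrow> (bit \<Rightarrow> ('f^'n) set) \<Rightarrow> bool" where
  "Der_one_dimensional_lie_algebra m C \<longleftrightarrow>
     Der_part m C 1 = {0} \<and> lie_algebra_on map_scale commutator (Der m C) \<and> map_dim (Der m C) = 1"

section \<open>The superalgebras \<open>D\<^sub>t(\<alpha>,\<beta>,\<gamma>)\<close>\<close>

datatype idx = E1 | E2 | X | Y

lemma UNIV_idx: "UNIV = {E1, E2, X, Y}"
  using idx.exhaust by blast

instance idx :: finite
  by standard (simp add: UNIV_idx)

definition e1 :: "'f::field^idx" where "e1 = axis E1 1"
definition e2 :: "'f::field^idx" where "e2 = axis E2 1"
definition ex :: "'f::field^idx" where "ex = axis X 1"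
definition ey :: "'f::field^idx" where "ey = axis Y 1"

fun D_table :: "'f::field \<Rightarrow> 'f \<Rightarrow> 'f \<Rightarrow> 'f \<Rightarrow> idx \<Rightarrow> idx \<Rightarrow> 'f^idx" where
  "D_table t \<alpha> \<beta> \<gamma> E1 E1 = e1"
| "D_table t \<alpha> \<beta> \<gamma> E2 E2 = e2"
| "D_table t \<alpha> \<beta> \<gamma> E1 E2 = 0"
| "D_table t \<alpha> \<beta> \<gamma> E2 E1 = 0"
| "D_table t \<alpha> \<beta> \<gamma> E1 X = \<alpha> *s ex + \<beta> *s ey"
| "D_table t \<alpha> \<beta> \<gamma> E1 Y = \<gamma> *s ex + (1 - \<alpha>) *s ey"
| "D_table t \<alpha> \<beta> \<gamma> E2 X = (1 - \<alpha>) *s ex - \<beta> *s ey"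
| "D_table t \<alpha> \<beta> \<gamma> E2 Y = (- \<gamma>) *s ex + \<alpha> *s ey"
| "D_table t \<alpha> \<beta> \<gamma> X E1 = (1 - \<alpha>) *s ex - \<beta> *s ey"
| "D_table t \<alpha> \<beta> \<gamma> X E2 = \<alpha> *s ex + \<beta> *s ey"
| "D_table t \<alpha> \<beta> \<gamma> Y E1 = (- \<gamma>) *s ex + \<alpha> *s ey"
| "D_table t \<alpha> \<beta> \<gamma> Y E2 = \<gamma> *s ex + (1 - \<alpha>) *s ey"
| "D_table t \<alpha> \<beta> \<gamma> X X = (- 2 * \<beta>) *s (e1 - t *s e2)"
| "D_table t \<alpha> \<beta> \<gamma> X Y = 2 *s (\<alpha> *s e1 + ((1 - \<alpha>) * t) *s e2)"
| "D_table t \<alpha> \<beta> \<gamma> Y X = (- 2) *s ((1 - \<alpha>) *s e1 + (\<alpha> * t) *s e2)"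
| "D_table t \<alpha> \<beta> \<gamma> Y Y = (2 * \<gamma>) *s (e1 - t *s e2)"

definition D_mult :: "'f::field \<Rightarrow> 'f \<Rightarrow> 'f \<Rightarrow> 'f \<Rightarrow> 'f^idx \<Rightarrow> 'f^idx \<Rightarrow> 'f^idx" where
  "D_mult t \<alpha> \<beta> \<gamma> u v = (\<Sum>i\<in>UNIV. \<Sum>j\<in>UNIV. (u $ i * v $ j) *s D_table t \<alpha> \<beta> \<gamma> i j)"

definition D_part :: "bit \<Rightarrow> ('f::field^idx) set" where
  "D_part p = (if p = 0 then vec.span {e1, e2} else vec.span {ex, ey})"

end

theory Submission
  imports Defs
begin

text \<open>
  By bilinearity the Leibniz rule only has to be checked on the basis \<open>e\<^sub>1, e\<^sub>2, x, y\<close>, where it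
  becomes a system of polynomial equations that can be solved for all \<open>\<alpha>, \<beta>, \<gamma>\<close> at once.
  An even derivation kills \<open>e\<^sub>1\<close> and \<open>e\<^sub>2\<close>, and its action on the odd part is a traceless
  matrix commuting with the action of \<open>e\<^sub>1\<close>. For \<open>D\<^sub>t\<close> this action is scalar, which leaves all
  of \<open>sl\<^sub>2\<close>; in the other two cases the commutant of the action meets \<open>sl\<^sub>2\<close> in a line.
  An odd derivation is determined by its value \<open>p x + q y\<close> at \<open>e\<^sub>1\<close>, since it kills the unit
  \<open>e\<^sub>1 + e\<^sub>2\<close> and \<open>e\<^sub>1 x + x e\<^sub>1 = x\<close>, \<open>e\<^sub>1 y + y e\<^sub>1 = y\<close>. The remaining conditions on \<open>p, q\<close>
  all carry the factor \<open>t + 1\<close>; they are void for \<open>D\<^sub>t\<close>, and in the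
  other cases they force \<open>p = q = 0\<close> once \<open>t \<noteq> - 1\<close> (and \<open>3 \<noteq> 0\<close> for \<open>D\<^sub>t\<^sup>1\<^sup>/\<^sup>2\<close>).
\<close>

section \<open>Derivations of a graded algebra and their commutators\<close>

text \<open>Additivity of the maps alone makes the terms of the Jacobi sum cancel pointwise, so for
  a space of linear maps closure under \<open>commutator\<close> is the only real condition.\<close>

lemma lie_algebra_on_commutator:
  assumes "map_vs.subspace L"
    and lin: "\<And>d. d \<in> L \<Longrightarrow> Vector_Spaces.linear (*s) (*s) d"
    and "\<And>d d'. d \<in> L \<Longrightarrow> d' \<in> L \<Longrightarrow> commutator d d' \<in> L"
  shows "lie_algebra_on map_scale commutator L"
proof -
  have lins: "d (u + v) = d u + d v" "d (u - v) = d u - d v" "d (k *s u) = k *s d u"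
    if "d \<in> L" for d k u v
    using lin[OF that] by (auto simp: vec.linear_add vec.linear_diff vec.linear_scale)
  show ?thesis
    unfolding lie_algebra_on_def
    using assms(1,3) map_vs.vector_space_axioms
    by (auto simp: commutator_def map_scale_def fun_eq_iff lins vec.scale_right_diff_distrib)
qed

locale graded_algebra =
  fixes m :: "'f::field^'n \<Rightarrow> 'f^'n \<Rightarrow> 'f^'n" and C :: "bit \<Rightarrow> ('f^'n) set"
  assumes add_left: "m (a + b) c = m a c + m b c"
    and add_right: "m a (b + c) = m a b + m a c"
    and scale_left: "m (k *s a) b = k *s m a b"
    and scale_right: "m a (k *s b) = k *s m a b"
    and subspace_C: "vec.subspace (C q)"
begin

lemma diff_left: "m (a - b) c = m a c - m b c"
  using add_left[of "a - b" b c] by (simp add: algebra_simps)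

lemma diff_right: "m a (b - c) = m a b - m a c"
  using add_right[of a "b - c" c] by (simp add: algebra_simps)

lemma zero_left [simp]: "m 0 b = 0"
  using diff_left[of 0 0 b] by simp

lemma zero_right [simp]: "m a 0 = 0"
  using diff_right[of a 0 0] by simp

lemma Der_part_linear: "d \<in> Der_part m C p \<Longrightarrow> Vector_Spaces.linear (*s) (*s) d"
  by (simp add: Der_part_def is_derivation_def)

lemma zero_in_Der_part: "0 \<in> Der_part m C p"
  using vec.subspace_0[OF subspace_C] vec.linear_zero
  by (auto simp: Der_part_def is_derivation_def zero_fun_def)

lemma subspace_Der_part: "map_vs.subspace (Der_part m C p)"
proof (rule map_vs.subspaceI)
  show "0 \<in> Der_part m C p" by (rule zero_in_Der_part)
next
  fix d d' assume "d \<in> Der_part m C p" "d' \<in> Der_part m C p"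
  then show "d + d' \<in> Der_part m C p"
    unfolding Der_part_def is_derivation_def plus_fun_def
    by (auto simp: vec.linear_compose_add vec.subspace_add[OF subspace_C] add_left add_right
        vec.scale_right_distrib)
next
  fix k d assume "d \<in> Der_part m C p"
  then show "map_scale k d \<in> Der_part m C p"
    unfolding Der_part_def is_derivation_def map_scale_def
    by (auto simp: vec.linear_compose_scale_right vec.subspace_scale[OF subspace_C] scale_left
        scale_right vec.scale_right_distrib mult.commute)
qed

text \<open>Even maps preserve each component, so the Leibniz rule applies a second time to
  \<open>d a\<close> and \<open>d b\<close>. The mixed terms \<open>m (d a) (d' b)\<close> and
  \<open>m (d' a) (d b)\<close> occur in both double applications and cancel in the
  difference.\<close>

lemma commutator_Der_part_0:
  assumes "d \<in> Der_part m C 0" "d' \<in> Der_part m C 0"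
  shows "commutator d d' \<in> Der_part m C 0"
proof -
  have lin: "Vector_Spaces.linear (*s) (*s) d" "Vector_Spaces.linear (*s) (*s) d'"
    and C': "\<And>q a. a \<in> C q \<Longrightarrow> d a \<in> C (q + 0)" "\<And>q a. a \<in> C q \<Longrightarrow> d' a \<in> C (q + 0)"
    and L: "\<And>q r a b. a \<in> C q \<Longrightarrow> b \<in> C r \<Longrightarrow> d (m a b) = m (d a) b + m a (d b)"
      "\<And>q r a b. a \<in> C q \<Longrightarrow> b \<in> C r \<Longrightarrow> d' (m a b) = m (d' a) b + m a (d' b)"
    using assms by (auto simp: Der_part_def is_derivation_def parity_sign_def)
  note C = C'[unfolded add_0_right]
  have "Vector_Spaces.linear (*s) (*s) (commutator d d')"
    unfolding commutator_def
    using vec.linear_compose_sub[OF Vector_Spaces.linear_compose[OF lin] Vector_Spaces.linear_compose[OF lin(2,1)]]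
    by (simp add: o_def)
  moreover have "commutator d d' a \<in> C q" if "a \<in> C q" for q a
    using that by (simp add: commutator_def C vec.subspace_diff[OF subspace_C])
  moreover have "commutator d d' (m a b) = m (commutator d d' a) b + m a (commutator d d' b)"
    if "a \<in> C q" "b \<in> C r" for q r a b
  proof -
    have "d' (d (m a b)) = m (d' (d a)) b + m (d a) (d' b) + (m (d' a) (d b) + m a (d' (d b)))"
      by (simp add: L[OF that] L(2)[of _ q _ r] that C vec.linear_add[OF lin(2)])
    moreover have "d (d' (m a b)) = m (d (d' a)) b + m (d' a) (d b) + (m (d a) (d' b) + m a (d (d' b)))"
      by (simp add: L[OF that] L(1)[of _ q _ r] that C vec.linear_add[OF lin(1)])
    ultimately show ?thesis
      by (simp add: commutator_def diff_left diff_right)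
  qed
  ultimately show ?thesis
    by (auto simp: Der_part_def is_derivation_def parity_sign_def)
qed

text \<open>The sign depends only on the component of the right factor. Hence, with the other factor
  fixed, the vectors satisfying the Leibniz identity form a subspace, and two nested span inductions
  extend it from generators to whole components. The degree condition extends because
  \<open>C (q + p)\<close> is a subspace.\<close>

lemma Der_part_iff_span:
  assumes C: "\<And>q. C q = vec.span (B q)"
  shows "d \<in> Der_part m C p \<longleftrightarrow> Vector_Spaces.linear (*s) (*s) d \<and>
     (\<forall>q. \<forall>a\<in>B q. d a \<in> C (q + p)) \<and>
     (\<forall>q r. \<forall>a\<in>B q. \<forall>b\<in>B r. d (m a b) = parity_sign p r *s m (d a) b + m a (d b))"
    (is "_ \<longleftrightarrow> ?lin \<and> ?deg \<and> ?leib")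
proof
  assume "d \<in> Der_part m C p"
  then show "?lin \<and> ?deg \<and> ?leib"
    unfolding Der_part_def is_derivation_def using C vec.span_base by blast
next
  assume "?lin \<and> ?deg \<and> ?leib"
  then have lin: ?lin and deg: ?deg and leib: ?leib
    by blast+
  note lins = vec.linear_add[OF lin] vec.linear_scale[OF lin] vec.linear_0[OF lin]
  have "d a \<in> C (q + p)" if "a \<in> C q" for q a
    using that[unfolded C]
  proof (induction rule: vec.span_induct)
    case base
    show ?case
      by (auto intro!: vec.subspaceI simp: lins subspace_C vec.subspace_add vec.subspace_scale vec.subspace_0)
  qed (use deg in blast)
  moreover have "d (m a b) = parity_sign p r *s m (d a) b + m a (d b)"
    if "a \<in> C q" "b \<in> C r" for q r a b
    using that(1)[unfolded C]
  proof (induction rule: vec.span_induct)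
    case base
    show ?case
      by (auto intro!: vec.subspaceI simp: lins add_left add_right scale_left scale_right
          vec.scale_right_distrib mult.commute)
  next
    case (step a)
    show ?case
      using that(2)[unfolded C]
    proof (induction rule: vec.span_induct)
      case base
      show ?case
        by (auto intro!: vec.subspaceI simp: lins add_left add_right scale_left scale_right
            vec.scale_right_distrib mult.commute)
    qed (use leib step in blast)
  qed
  ultimately show "d \<in> Der_part m C p"
    using lin by (simp add: Der_part_def is_derivation_def)
qed

lemma lie_algebra_Der_part_0: "lie_algebra_on map_scale commutator (Der_part m C 0)"
  by (intro lie_algebra_on_commutator subspace_Der_part Der_part_linear commutator_Der_part_0)

lemma Der_eq_Der_part_0:
  assumes "Der_part m C 1 = {0}"
  shows "Der m C = Der_part m C 0"
  using assms zero_in_Der_part[of 0] map_vs.span_eq_iff subspace_Der_part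
  by (simp add: Der_def insert_absorb)

text \<open>Without odd derivations \<open>Der m C\<close> is its even part, which is already known
  to be a Lie algebra; only its dimension has to be read off from the generator.\<close>

lemma Der_one_dimensional_lie_algebraI:
  assumes "Der_part m C 1 = {0}" "Der_part m C 0 = map_span {d}" "d \<noteq> 0"
  shows "Der_one_dimensional_lie_algebra m C"
proof -
  have "map_dim (map_span {d}) = 1"
    using map_vs.dim_eq_card_independent[of "{d}"] assms(3) by simp
  then show ?thesis
    using assms lie_algebra_Der_part_0
    by (simp add: Der_one_dimensional_lie_algebra_def Der_eq_Der_part_0)
qed

end

section \<open>Coordinates and products in the superalgebras\<close>

lemma sum_idx: "(\<Sum>i\<in>UNIV. f i) = f E1 + f E2 + f X + f Y"
  by (simp add: UNIV_idx add.assoc)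

lemma all_idx: "(\<forall>i. P i) \<longleftrightarrow> P E1 \<and> P E2 \<and> P X \<and> P Y"
  by (metis idx.exhaust)

lemma basis_nth [simp]:
  "e1 $ i = (if i = E1 then 1 else 0)" "e2 $ i = (if i = E2 then 1 else 0)"
  "ex $ i = (if i = X then 1 else 0)" "ey $ i = (if i = Y then 1 else 0)"
  by (auto simp: e1_def e2_def ex_def ey_def axis_def)

lemma basis_expansion: "v = v $ E1 *s e1 + v $ E2 *s e2 + v $ X *s ex + v $ Y *s ey"
  by (simp add: vec_eq_iff all_idx)

lemma D_part_iff:
  "v \<in> D_part 0 \<longleftrightarrow> v $ X = 0 \<and> v $ Y = 0" "v \<in> D_part 1 \<longleftrightarrow> v $ E1 = 0 \<and> v $ E2 = 0"
  by (auto simp: D_part_def vec.span_breakdown_eq vec_eq_iff all_idx)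

text \<open>Collecting the table by coordinates lets each Leibniz identity split into four equations
  over the field.\<close>

lemma D_mult_nth:
  "D_mult t \<alpha> \<beta> \<gamma> u v $ E1 = u $ E1 * v $ E1 - 2 * \<beta> * (u $ X * v $ X) + 2 * \<alpha> * (u $ X * v $ Y)
     - 2 * (1 - \<alpha>) * (u $ Y * v $ X) + 2 * \<gamma> * (u $ Y * v $ Y)"
  "D_mult t \<alpha> \<beta> \<gamma> u v $ E2 = u $ E2 * v $ E2 + 2 * \<beta> * t * (u $ X * v $ X)
     + 2 * (1 - \<alpha>) * t * (u $ X * v $ Y) - 2 * \<alpha> * t * (u $ Y * v $ X) - 2 * \<gamma> * t * (u $ Y * v $ Y)"
  "D_mult t \<alpha> \<beta> \<gamma> u v $ X = (u $ E1 * v $ X + u $ X * v $ E2) * \<alpha> + (u $ E2 * v $ X + u $ X * v $ E1) * (1 - \<alpha>)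
     + (u $ E1 * v $ Y - u $ E2 * v $ Y - u $ Y * v $ E1 + u $ Y * v $ E2) * \<gamma>"
  "D_mult t \<alpha> \<beta> \<gamma> u v $ Y = (u $ E2 * v $ Y + u $ Y * v $ E1) * \<alpha> + (u $ E1 * v $ Y + u $ Y * v $ E2) * (1 - \<alpha>)
     + (u $ E1 * v $ X - u $ E2 * v $ X - u $ X * v $ E1 + u $ X * v $ E2) * \<beta>"
  by (simp_all add: D_mult_def sum_idx algebra_simps)

interpretation D: graded_algebra "D_mult t \<alpha> \<beta> \<gamma>" D_part
proof
  show "vec.subspace (D_part q :: ('a^idx) set)" for q
    by (simp add: D_part_def)
qed (simp_all add: D_mult_def vec_eq_iff sum_distrib_left sum.distrib[symmetric] algebra_simps)

text \<open>Unlike in \<open>D_table\<close>, products of odd elements appear here with the scalars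
  multiplied out, so that a linear map can be pushed directly onto \<open>e1\<close> and
  \<open>e2\<close>.\<close>

lemma D_mult_basis:
  "D_mult t \<alpha> \<beta> \<gamma> e1 e1 = e1"
  "D_mult t \<alpha> \<beta> \<gamma> e2 e2 = e2"
  "D_mult t \<alpha> \<beta> \<gamma> e1 e2 = 0"
  "D_mult t \<alpha> \<beta> \<gamma> e2 e1 = 0"
  "D_mult t \<alpha> \<beta> \<gamma> e1 ex = \<alpha> *s ex + \<beta> *s ey"
  "D_mult t \<alpha> \<beta> \<gamma> e1 ey = \<gamma> *s ex + (1 - \<alpha>) *s ey"
  "D_mult t \<alpha> \<beta> \<gamma> e2 ex = (1 - \<alpha>) *s ex - \<beta> *s ey"
  "D_mult t \<alpha> \<beta> \<gamma> e2 ey = (- \<gamma>) *s ex + \<alpha> *s ey"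
  "D_mult t \<alpha> \<beta> \<gamma> ex e1 = (1 - \<alpha>) *s ex - \<beta> *s ey"
  "D_mult t \<alpha> \<beta> \<gamma> ex e2 = \<alpha> *s ex + \<beta> *s ey"
  "D_mult t \<alpha> \<beta> \<gamma> ey e1 = (- \<gamma>) *s ex + \<alpha> *s ey"
  "D_mult t \<alpha> \<beta> \<gamma> ey e2 = \<gamma> *s ex + (1 - \<alpha>) *s ey"
  "D_mult t \<alpha> \<beta> \<gamma> ex ex = (- 2 * \<beta>) *s e1 + (2 * \<beta> * t) *s e2"
  "D_mult t \<alpha> \<beta> \<gamma> ex ey = (2 * \<alpha>) *s e1 + (2 * (1 - \<alpha>) * t) *s e2"
  "D_mult t \<alpha> \<beta> \<gamma> ey ex = (- 2 * (1 - \<alpha>)) *s e1 + (- 2 * \<alpha> * t) *s e2"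
  "D_mult t \<alpha> \<beta> \<gamma> ey ey = (2 * \<gamma>) *s e1 + (- 2 * \<gamma> * t) *s e2"
  by (simp_all add: vec_eq_iff all_idx D_mult_nth)

section \<open>Leibniz equations on the basis\<close>

lemma bit_all: "(\<forall>b::bit. P b) \<longleftrightarrow> P 0 \<and> P 1"
  by (metis bit_not_one_iff)

lemma Der_part_D_mult_iff:
  "d \<in> Der_part (D_mult t \<alpha> \<beta> \<gamma>) D_part p \<longleftrightarrow> Vector_Spaces.linear (*s) (*s) d \<and>
     d e1 \<in> D_part p \<and> d e2 \<in> D_part p \<and> d ex \<in> D_part (1 + p) \<and> d ey \<in> D_part (1 + p) \<and>
     (\<forall>a\<in>{e1, e2, ex, ey}.
       (\<forall>b\<in>{e1, e2}. d (D_mult t \<alpha> \<beta> \<gamma> a b) = D_mult t \<alpha> \<beta> \<gamma> (d a) b + D_mult t \<alpha> \<beta> \<gamma> a (d b)) \<and>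
       (\<forall>b\<in>{ex, ey}. d (D_mult t \<alpha> \<beta> \<gamma> a b) =
          parity_sign p 1 *s D_mult t \<alpha> \<beta> \<gamma> (d a) b + D_mult t \<alpha> \<beta> \<gamma> a (d b)))"
  by (subst D.Der_part_iff_span[where B = "\<lambda>q. if q = 0 then {e1, e2} else {ex, ey}"])
    (auto simp: D_part_def bit_all parity_sign_def)

text \<open>Let M have rows (p, q), (r, s) and A have rows (\<alpha>, \<beta>), (\<gamma>, 1 -
  \<alpha>), the matrices of \<open>d\<close> and of left multiplication by \<open>e1\<close> on the
  odd part. Once s = -p, the last three equations are the entries of MA = AM.\<close>

lemma Der_part_0_iff:
  assumes two: "(2::'f::field) \<noteq> 0"
    and lin: "Vector_Spaces.linear (*s) (*s) d"
    and d: "d e1 = a *s e1 + b *s e2" "d e2 = c *s e1 + e *s e2"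
      "d ex = p *s ex + q *s ey" "d ey = r *s ex + s *s ey"
  shows "d \<in> Der_part (D_mult t (\<alpha>::'f) \<beta> \<gamma>) D_part 0 \<longleftrightarrow>
    a = 0 \<and> b = 0 \<and> c = 0 \<and> e = 0 \<and> s = - p \<and>
    \<beta> * r = \<gamma> * q \<and> (2 * \<alpha> - 1) * q = 2 * \<beta> * p \<and> (2 * \<alpha> - 1) * r = 2 * \<gamma> * p"
    (is "_ \<longleftrightarrow> ?R")
proof -
  note lins = vec.linear_add[OF lin] vec.linear_diff[OF lin] vec.linear_scale[OF lin] vec.linear_0[OF lin]
  have two_neq_1: "(2::'f) \<noteq> 1"
    by (metis add_cancel_right_right one_add_one one_neq_zero)
  have *: "d \<in> Der_part (D_mult t (\<alpha>::'f) \<beta> \<gamma>) D_part 0 \<longleftrightarrow>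
    (\<forall>u\<in>{e1, e2, ex, ey}. \<forall>v\<in>{e1, e2, ex, ey}.
       d (D_mult t \<alpha> \<beta> \<gamma> u v) = D_mult t \<alpha> \<beta> \<gamma> (d u) v + D_mult t \<alpha> \<beta> \<gamma> u (d v))"
    unfolding Der_part_D_mult_iff by (auto simp: lin d D_part_iff parity_sign_def)
  show ?thesis
  proof
    assume "d \<in> Der_part (D_mult t \<alpha> \<beta> \<gamma>) D_part 0"
    note L = this[unfolded *, rule_format]
    \<comment> \<open>Idempotence of \<open>e1\<close> gives a e1 + b e2 = 2a e1, that of
      \<open>e2\<close> gives c e1 + e e2 = 2e e2.\<close>
    have "a = 0" "b = 0" "e = 0" "c = 0"
      using L[of e1 e1] L[of e2 e2] two_neq_1
      by (simp_all add: D_mult_basis d vec_eq_iff all_idx D_mult_nth)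
    note d' = d[unfolded this]
    have "\<beta> * r = \<gamma> * q" "\<alpha> * q + \<beta> * s = p * \<beta> + q * (1 - \<alpha>)"
      using L[of e1 ex] by (simp_all add: D_mult_basis d' vec_eq_iff all_idx D_mult_nth lins algebra_simps)
    moreover have "\<gamma> * p + (1 - \<alpha>) * r = r * \<alpha> + s * \<gamma>"
      using L[of e1 ey] by (simp_all add: D_mult_basis d' vec_eq_iff all_idx D_mult_nth lins algebra_simps)
    moreover have "2 * (\<alpha> * (p + s)) = 2 * (\<beta> * r - \<gamma> * q)"
      using L[of ex ey] by (simp add: D_mult_basis d' vec_eq_iff all_idx D_mult_nth lins algebra_simps)
    moreover have "2 * ((1 - \<alpha>) * (p + s)) = 2 * (\<gamma> * q - \<beta> * r)"
      using L[of ey ex] by (simp add: D_mult_basis d' vec_eq_iff all_idx D_mult_nth lins algebra_simps)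
    \<comment> \<open>The sum of the equations from xy and yx: the coefficients \<alpha> and 1 -
      \<alpha> add up to 1 and the right-hand sides cancel. This is the trace condition.\<close>
    ultimately have "2 * (p + s) = 0"
      and x: "\<beta> * r = \<gamma> * q" "\<alpha> * q + \<beta> * s = p * \<beta> + q * (1 - \<alpha>)" "\<gamma> * p + (1 - \<alpha>) * r = r * \<alpha> + s * \<gamma>"
      by algebra+
    then have "s = - p" using two by (metis add_eq_0_iff mult_eq_0_iff)
    then show ?R using x \<open>a = 0\<close> \<open>b = 0\<close> \<open>c = 0\<close> \<open>e = 0\<close>
      by (simp add: algebra_simps)
  next
    assume R: ?R
    then have z: "a = 0" "b = 0" "c = 0" "e = 0" "s = - p"
        and y: "\<beta> * r = \<gamma> * q" "(2 * \<alpha> - 1) * q = 2 * \<beta> * p" "(2 * \<alpha> - 1) * r = 2 * \<gamma> * p" by blast+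
    show "d \<in> Der_part (D_mult t \<alpha> \<beta> \<gamma>) D_part 0"
      unfolding *
      by (simp add: d z D_mult_basis lins vec_eq_iff all_idx D_mult_nth)
        (intro conjI; use y in algebra)
  qed
qed

text \<open>The products involving \<open>e1\<close> and \<open>e2\<close> express all coefficients
  through p and q; the squares of x and y then supply the four constraints on p and q.\<close>

lemma Der_part_1_iff:
  assumes two: "(2::'f::field) \<noteq> 0"
    and lin: "Vector_Spaces.linear (*s) (*s) d"
    and d: "d e1 = p *s ex + q *s ey" "d e2 = r *s ex + s *s ey"
     "d ex = a *s e1 + b *s e2" "d ey = c *s e1 + e *s e2"
  shows "d \<in> Der_part (D_mult t (\<alpha>::'f) \<beta> \<gamma>) D_part 1 \<longleftrightarrow>
    r = - p \<and> s = - q \<and> a = - 2 * q \<and> b = 2 * t * q \<and> c = 2 * p \<and> e = - 2 * t * p \<and>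
    (t + 1) * ((2 * \<alpha> - 1) * q + \<beta> * p) = 0 \<and> (t + 1) * ((2 * \<alpha> - 1) * p - \<gamma> * q) = 0 \<and>
    (t + 1) * (3 * \<beta> * q) = 0 \<and> (t + 1) * (3 * \<gamma> * p) = 0"
    (is "_ \<longleftrightarrow> ?R")
proof -
  note lins = vec.linear_add[OF lin] vec.linear_diff[OF lin] vec.linear_scale[OF lin] vec.linear_0[OF lin]
  have *: "d \<in> Der_part (D_mult t (\<alpha>::'f) \<beta> \<gamma>) D_part 1 \<longleftrightarrow>
    (\<forall>u\<in>{e1, e2, ex, ey}.
       (\<forall>v\<in>{e1, e2}. d (D_mult t \<alpha> \<beta> \<gamma> u v) = D_mult t \<alpha> \<beta> \<gamma> (d u) v + D_mult t \<alpha> \<beta> \<gamma> u (d v)) \<and>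
       (\<forall>v\<in>{ex, ey}. d (D_mult t \<alpha> \<beta> \<gamma> u v) =
          - D_mult t \<alpha> \<beta> \<gamma> (d u) v + D_mult t \<alpha> \<beta> \<gamma> u (d v)))"
    unfolding Der_part_D_mult_iff by (auto simp: lin d D_part_iff parity_sign_def)
  show ?thesis
  proof
    assume "d \<in> Der_part (D_mult t \<alpha> \<beta> \<gamma>) D_part 1"
    then have L:
      "\<And>u v. u \<in> {e1, e2, ex, ey} \<Longrightarrow> v \<in> {e1, e2} \<Longrightarrow>
        d (D_mult t \<alpha> \<beta> \<gamma> u v) = D_mult t \<alpha> \<beta> \<gamma> (d u) v + D_mult t \<alpha> \<beta> \<gamma> u (d v)"
      "\<And>u v. u \<in> {e1, e2, ex, ey} \<Longrightarrow> v \<in> {ex, ey} \<Longrightarrow>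
        d (D_mult t \<alpha> \<beta> \<gamma> u v) = - D_mult t \<alpha> \<beta> \<gamma> (d u) v + D_mult t \<alpha> \<beta> \<gamma> u (d v)"
      unfolding * by blast+
    note S = D_mult_basis d vec_eq_iff all_idx D_mult_nth lins
    have 1: "p * \<alpha> + q * \<gamma> + (r * \<alpha> + s * \<gamma>) = 0" "q * (1 - \<alpha>) + p * \<beta> + (s * (1 - \<alpha>) + r * \<beta>) = 0"
      using L(1)[of e1 e2] by (simp_all add: S)
    have 2: "r * (1 - \<alpha>) - s * \<gamma> + (p * (1 - \<alpha>) - q * \<gamma>) = 0" "s * \<alpha> - r * \<beta> + (q * \<alpha> - p * \<beta>) = 0"
      using L(1)[of e2 e1] by (simp_all add: S)
    have 3: "\<alpha> * a + \<beta> * c = a + 2 * \<beta> * p + 2 * (1 - \<alpha>) * q" "\<alpha> * b + \<beta> * e = 2 * \<alpha> * t * q - 2 * \<beta> * t * p"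
      using L(2)[of e1 ex] by (simp_all add: S algebra_simps)
    have 4: "- \<alpha> * a - \<beta> * c = 2 * \<alpha> * q - 2 * \<beta> * p" "b - \<alpha> * b - \<beta> * e = 2 * \<beta> * t * p + 2 * (1 - \<alpha>) * t * q"
      using L(1)[of ex e1] by (simp_all add: S algebra_simps)
    have 5: "\<gamma> * a - \<alpha> * c = - 2 * \<alpha> * p - 2 * \<gamma> * q"
      "\<gamma> * b + (1 - \<alpha>) * e = 2 * \<gamma> * t * q - 2 * (1 - \<alpha>) * t * p"
      using L(2)[of e1 ey] by (simp_all add: S algebra_simps)
    have 6: "\<alpha> * c - \<gamma> * a = c + 2 * \<gamma> * q - 2 * (1 - \<alpha>) * p"
      "\<alpha> * e - \<gamma> * b = - 2 * \<alpha> * t * p - 2 * \<gamma> * t * q"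
      using L(1)[of ey e1] by (simp_all add: S algebra_simps)
    have 7: "2 * (\<beta> * t * r - \<beta> * p) = b * \<alpha> + a * (1 - \<alpha>) - (a * \<alpha> + b * (1 - \<alpha>))"
      "2 * (\<beta> * t * s - \<beta> * q) = 2 * \<beta> * (b - a)"
      using L(2)[of ex ex] by (simp_all add: S algebra_simps)
    have 8: "2 * (\<gamma> * p - \<gamma> * t * r) = 2 * \<gamma> * (e - c)"
      "2 * (\<gamma> * q - \<gamma> * t * s) = (c - e) * (2 * \<alpha> - 1)"
      using L(2)[of ey ey] by (simp_all add: S algebra_simps)
    \<comment> \<open>Adding 1 to 2, 3 to 4 and 5 to 6 eliminates \<alpha>, \<beta>, \<gamma>. The
      sums express that \<open>d\<close> respects e1 e2 + e2 e1 = 0, e1 x + x e1 = x and e1 y + y e1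
      = y.\<close>
    have z: "r = - p" "s = - q" "a = - 2 * q" "b = 2 * t * q" "c = 2 * p" "e = - 2 * t * p"
      using 1 2 3 4 5 6 by algebra+
    \<comment> \<open>The factor t + 1 comes from b - a = 2(t + 1)q and c - e = 2(t + 1)p. The 3
      arises as 1 + 2 when, say, -2\<beta>(t + 1)q is equated with 4\<beta>(t + 1)q.\<close>
    have "2 * ((t + 1) * ((2 * \<alpha> - 1) * q + \<beta> * p)) = 0" "2 * ((t + 1) * ((2 * \<alpha> - 1) * p - \<gamma> * q)) = 0"
      "2 * ((t + 1) * (3 * \<beta> * q)) = 0" "2 * ((t + 1) * (3 * \<gamma> * p)) = 0"
      using 7 8 unfolding z by algebra+
    then show ?R using z two by (metis mult_eq_0_iff)
  next
    assume R: ?R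
    then have z: "r = - p" "s = - q" "a = - 2 * q" "b = 2 * t * q" "c = 2 * p" "e = - 2 * t * p"
        and y: "(t + 1) * ((2 * \<alpha> - 1) * q + \<beta> * p) = 0" "(t + 1) * ((2 * \<alpha> - 1) * p - \<gamma> * q) = 0"
        "(t + 1) * (3 * \<beta> * q) = 0" "(t + 1) * (3 * \<gamma> * p) = 0" by blast+
    show "d \<in> Der_part (D_mult t \<alpha> \<beta> \<gamma>) D_part 1"
      unfolding *
      by (simp add: d z D_mult_basis lins vec_eq_iff all_idx D_mult_nth)
        (intro conjI; (algebra | use y in algebra))
  qed
qed

section \<open>Explicit even and odd derivation spaces\<close>

definition basis_map :: "'f::field^idx \<Rightarrow> 'f^idx \<Rightarrow> 'f^idx \<Rightarrow> 'f^idx \<Rightarrow> 'f^idx \<Rightarrow> 'f^idx" where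
  "basis_map a b c e v = v $ E1 *s a + v $ E2 *s b + v $ X *s c + v $ Y *s e"

lemma linear_basis_map: "Vector_Spaces.linear (*s) (*s) (basis_map a b c e)"
  by unfold_locales (simp_all add: basis_map_def vec_eq_iff algebra_simps)

lemma basis_map_simps [simp]:
  "basis_map a b c e e1 = a" "basis_map a b c e e2 = b"
  "basis_map a b c e ex = c" "basis_map a b c e ey = e"
  by (simp_all add: basis_map_def)

lemma linear_eq_basis_map:
  assumes "Vector_Spaces.linear (*s) (*s) d"
  shows "d = basis_map (d e1) (d e2) (d ex) (d ey)"
proof
  fix v
  have "d v = d (v $ E1 *s e1 + v $ E2 *s e2 + v $ X *s ex + v $ Y *s ey)"
    by (simp flip: basis_expansion)
  then show "d v = basis_map (d e1) (d e2) (d ex) (d ey) v"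
    by (simp add: vec.linear_add[OF assms] vec.linear_scale[OF assms] basis_map_def)
qed

lemma Der_part_0_eq:
  assumes two: "(2::'f::field) \<noteq> 0"
  shows "Der_part (D_mult t (\<alpha>::'f) \<beta> \<gamma>) D_part 0 =
    {d. Vector_Spaces.linear (*s) (*s) d \<and> (\<exists>p q r.
       \<beta> * r = \<gamma> * q \<and> (2 * \<alpha> - 1) * q = 2 * \<beta> * p \<and> (2 * \<alpha> - 1) * r = 2 * \<gamma> * p \<and>
       d e1 = 0 \<and> d e2 = 0 \<and> d ex = p *s ex + q *s ey \<and> d ey = r *s ex - p *s ey)}"
    (is "?L = ?R")
proof (intro set_eqI iffI)
  fix d assume d: "d \<in> ?L"
  then have lin: "Vector_Spaces.linear (*s) (*s) d"
    and "d e1 \<in> D_part 0" "d e2 \<in> D_part 0" "d ex \<in> D_part 1" "d ey \<in> D_part 1"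
    by (simp_all add: Der_part_D_mult_iff)
  \<comment> \<open>The degree condition puts \<open>d\<close> into the shape that
    \<open>Der_part_0_iff\<close> presupposes, with the coordinates as its coefficients.\<close>
  then have form: "d e1 = d e1 $ E1 *s e1 + d e1 $ E2 *s e2" "d e2 = d e2 $ E1 *s e1 + d e2 $ E2 *s e2"
    "d ex = d ex $ X *s ex + d ex $ Y *s ey" "d ey = d ey $ X *s ex + d ey $ Y *s ey"
    by (simp_all add: D_part_iff vec_eq_iff all_idx)
  from d[unfolded Der_part_0_iff[OF two lin form]] form lin show "d \<in> ?R"
    by (auto intro!: exI[of _ "d ex $ X"] exI[of _ "d ex $ Y"] exI[of _ "d ey $ X"]
        simp: vec_eq_iff all_idx)
next
  fix d assume "d \<in> ?R"
  then obtain p q r where lin: "Vector_Spaces.linear (*s) (*s) d" and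
    "\<beta> * r = \<gamma> * q" "(2 * \<alpha> - 1) * q = 2 * \<beta> * p" "(2 * \<alpha> - 1) * r = 2 * \<gamma> * p"
    \<comment> \<open>Zero is written as a combination to match the shape in
      \<open>Der_part_0_iff\<close>.\<close>
    and "d e1 = 0 *s e1 + 0 *s e2" "d e2 = 0 *s e1 + 0 *s e2"
      "d ex = p *s ex + q *s ey" "d ey = r *s ex + (- p) *s ey"
    by (auto simp: vec.scale_minus_left)
  then show "d \<in> ?L"
    by (subst Der_part_0_iff[OF two]) auto
qed

lemma Der_part_1_eq:
  assumes two: "(2::'f::field) \<noteq> 0"
  shows "Der_part (D_mult t (\<alpha>::'f) \<beta> \<gamma>) D_part 1 =
    {d. Vector_Spaces.linear (*s) (*s) d \<and> (\<exists>p q.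
       (t + 1) * ((2 * \<alpha> - 1) * q + \<beta> * p) = 0 \<and> (t + 1) * ((2 * \<alpha> - 1) * p - \<gamma> * q) = 0 \<and>
       (t + 1) * (3 * \<beta> * q) = 0 \<and> (t + 1) * (3 * \<gamma> * p) = 0 \<and>
       d e1 = p *s ex + q *s ey \<and> d e2 = - (p *s ex + q *s ey) \<and>
       d ex = 2 *s ((- q) *s e1 + (q * t) *s e2) \<and> d ey = 2 *s (p *s e1 - (p * t) *s e2))}"
    (is "?L = ?R")
proof (intro set_eqI iffI)
  fix d assume d: "d \<in> ?L"
  then have lin: "Vector_Spaces.linear (*s) (*s) d"
    and "d e1 \<in> D_part 1" "d e2 \<in> D_part 1" "d ex \<in> D_part 0" "d ey \<in> D_part 0"
    by (simp_all add: Der_part_D_mult_iff)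
  then have form: "d e1 = d e1 $ X *s ex + d e1 $ Y *s ey" "d e2 = d e2 $ X *s ex + d e2 $ Y *s ey"
    "d ex = d ex $ E1 *s e1 + d ex $ E2 *s e2" "d ey = d ey $ E1 *s e1 + d ey $ E2 *s e2"
    by (simp_all add: D_part_iff vec_eq_iff all_idx)
  from d[unfolded Der_part_1_iff[OF two lin form]] form lin show "d \<in> ?R"
    by (auto intro!: exI[of _ "d e1 $ X"] exI[of _ "d e1 $ Y"] simp: vec_eq_iff all_idx)
next
  fix d assume "d \<in> ?R"
  then obtain p q where lin: "Vector_Spaces.linear (*s) (*s) d"
    and pq: "(t + 1) * ((2 * \<alpha> - 1) * q + \<beta> * p) = 0" "(t + 1) * ((2 * \<alpha> - 1) * p - \<gamma> * q) = 0"
      "(t + 1) * (3 * \<beta> * q) = 0" "(t + 1) * (3 * \<gamma> * p) = 0"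
    and d: "d e1 = p *s ex + q *s ey" "d e2 = - (p *s ex + q *s ey)"
       "d ex = 2 *s ((- q) *s e1 + (q * t) *s e2)" "d ey = 2 *s (p *s e1 - (p * t) *s e2)"
    by blast
  have form: "d e2 = (- p) *s ex + (- q) *s ey" "d ex = (- 2 * q) *s e1 + (2 * t * q) *s e2"
    "d ey = (2 * p) *s e1 + (- 2 * t * p) *s e2"
    by (simp_all add: d vec_eq_iff all_idx)
  show "d \<in> ?L"
    unfolding Der_part_1_iff[OF two lin d(1) form] using pq by simp
qed

section \<open>Algebras with a one-dimensional derivation algebra\<close>

text \<open>Common to items (2) and (3). Since t + 1 can be cancelled, \<open>odd\<close> states
  that the constraints of \<open>Der_part_1_iff\<close> have only the trivial solution. The even
  part is spanned by the map that kills \<open>e1\<close>, \<open>e2\<close> and sends x to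
  \<open>u\<close> and y to \<open>v\<close>.\<close>

lemma D_one_dimensional_lie_algebraI:
  assumes two: "(2::'f::field) \<noteq> 0"
    and odd: "\<And>p q. \<lbrakk>(2 * \<alpha> - 1) * q + \<beta> * p = 0; (2 * \<alpha> - 1) * p - \<gamma> * q = 0; 3 * \<beta> * q = 0; 3 * \<gamma> * p = 0\<rbrakk>
       \<Longrightarrow> p = 0 \<and> q = 0"
    and even: "Der_part (D_mult t (\<alpha>::'f) \<beta> \<gamma>) D_part 0 =
      {d. Vector_Spaces.linear (*s) (*s) d \<and> (\<exists>k. d e1 = 0 \<and> d e2 = 0 \<and> d ex = k *s u \<and> d ey = k *s v)}"
    and t: "t \<noteq> - 1" and uv: "u \<noteq> 0 \<or> v \<noteq> 0"
  shows "Der_one_dimensional_lie_algebra (D_mult t \<alpha> \<beta> \<gamma>) D_part"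
proof (rule D.Der_one_dimensional_lie_algebraI)
  have t1: "t + 1 \<noteq> 0"
    using t by (simp add: add_eq_0_iff2)
  show "Der_part (D_mult t \<alpha> \<beta> \<gamma>) D_part 1 = {0}"
  proof (intro equalityI subsetI)
    fix d assume "d \<in> Der_part (D_mult t \<alpha> \<beta> \<gamma>) D_part 1"
    then obtain p q where lin: "Vector_Spaces.linear (*s) (*s) d"
      and pq: "(t + 1) * ((2 * \<alpha> - 1) * q + \<beta> * p) = 0" "(t + 1) * ((2 * \<alpha> - 1) * p - \<gamma> * q) = 0"
      "(t + 1) * (3 * \<beta> * q) = 0" "(t + 1) * (3 * \<gamma> * p) = 0"
      and d: "d e1 = p *s ex + q *s ey" "d e2 = - (p *s ex + q *s ey)"
       "d ex = 2 *s ((- q) *s e1 + (q * t) *s e2)" "d ey = 2 *s (p *s e1 - (p * t) *s e2)"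
      unfolding Der_part_1_eq[OF two] by blast
    from pq t1 have "p = 0 \<and> q = 0"
      by (intro odd) (simp_all only: mult_eq_0_iff simp_thms)
    then have "d = basis_map 0 0 0 0"
      by (subst linear_eq_basis_map[OF lin]) (simp add: d)
    then show "d \<in> {0}"
      by (simp add: fun_eq_iff basis_map_def)
  qed (use D.zero_in_Der_part in auto)
  show "Der_part (D_mult t \<alpha> \<beta> \<gamma>) D_part 0 = map_span {basis_map 0 0 u v}"
  proof (intro equalityI subsetI)
    fix d assume "d \<in> Der_part (D_mult t \<alpha> \<beta> \<gamma>) D_part 0"
    then obtain k where lin: "Vector_Spaces.linear (*s) (*s) d"
      and d: "d e1 = 0" "d e2 = 0" "d ex = k *s u" "d ey = k *s v"
      unfolding even by blast
    have "d = map_scale k (basis_map 0 0 u v)"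
      by (subst linear_eq_basis_map[OF lin])
        (simp add: d fun_eq_iff map_scale_def basis_map_def vec_eq_iff algebra_simps)
    then show "d \<in> map_span {basis_map 0 0 u v}"
      by (auto simp: map_vs.span_singleton)
  next
    fix d assume "d \<in> map_span {basis_map 0 0 u v}"
    then obtain k where "d = map_scale k (basis_map 0 0 u v)"
      by (auto simp: map_vs.span_singleton)
    then show "d \<in> Der_part (D_mult t \<alpha> \<beta> \<gamma>) D_part 0"
      unfolding even using vec.linear_compose_scale_right[OF linear_basis_map]
      by (auto simp: map_scale_def)
  qed
  show "basis_map 0 0 u v \<noteq> 0"
    using uv basis_map_simps(3,4)[of 0 0 u v] by (metis zero_fun_def)
qed

section \<open>The isomorphism of the even part with traceless matrices\<close>

lemma trace_2: "trace (A :: 'f::field^2^2) = A $ 1 $ 1 + A $ 2 $ 2"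
  by (simp add: trace_def sum_2)

lemma lie_algebra_sl2: "lie_algebra_on mat_scale mat_bracket (sl2 :: ('f::field^2^2) set)"
proof -
  have vs: "vector_space (mat_scale :: 'f \<Rightarrow> 'f^2^2 \<Rightarrow> 'f^2^2)"
    by unfold_locales (simp_all add: mat_scale_def vec_eq_iff algebra_simps)
  then have "module (mat_scale :: 'f \<Rightarrow> 'f^2^2 \<Rightarrow> 'f^2^2)"
    by (simp add: module_iff_vector_space)
  note sub = module.subspace_def[OF this]
  show ?thesis
    unfolding lie_algebra_on_def sub
    by (simp add: vs)
      (simp add: sl2_def mat_bracket_def mat_scale_def trace_2 matrix_matrix_mult_def sum_2
        vec_eq_iff forall_2 algebra_simps, metis distrib_left mult_zero_right)
qed

lemma D_even_lie_isomorphic_sl2: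
  assumes even: "Der_part m C 0 =
      {d. Vector_Spaces.linear (*s) (*s) d \<and> (\<exists>p q r::'f::field. d e1 = 0 \<and> d e2 = 0 \<and>
        d ex = p *s ex + q *s ey \<and> d ey = r *s ex - p *s ey)}"
    and "graded_algebra m C"
  shows "lie_isomorphic map_scale commutator (Der_part m C 0) mat_scale mat_bracket (sl2 :: ('f^2^2) set)"
proof -
  let ?L = "Der_part m C 0"
  \<comment> \<open>Images are stored as rows. Applying \<open>d\<close> first and \<open>d'\<close>
    second then corresponds to the product \<open>\<phi> d ** \<phi> d'\<close>, so
    \<open>commutator\<close> goes to \<open>mat_bracket\<close> without a change of sign or
    order.\<close>
  define \<phi> :: "('f^idx \<Rightarrow> 'f^idx) \<Rightarrow> 'f^2^2" where
    "\<phi> d = vector [vector [d ex $ X, d ex $ Y], vector [d ey $ X, d ey $ Y]]" for d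
  have [simp]: "\<phi> d $ 1 $ 1 = d ex $ X" "\<phi> d $ 1 $ 2 = d ex $ Y"
    "\<phi> d $ 2 $ 1 = d ey $ X" "\<phi> d $ 2 $ 2 = d ey $ Y" for d
    by (simp_all add: \<phi>_def)
  have bij: "bij_betw \<phi> ?L sl2"
  proof (rule bij_betw_byWitness[where f' =
        "\<lambda>A. basis_map 0 0 (A $ 1 $ 1 *s ex + A $ 1 $ 2 *s ey) (A $ 2 $ 1 *s ex + A $ 2 $ 2 *s ey)"])
    show "\<forall>d\<in>?L. basis_map 0 0 (\<phi> d $ 1 $ 1 *s ex + \<phi> d $ 1 $ 2 *s ey)
        (\<phi> d $ 2 $ 1 *s ex + \<phi> d $ 2 $ 2 *s ey) = d"
    proof
      fix d assume "d \<in> ?L"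
      then obtain p q r where lin: "Vector_Spaces.linear (*s) (*s) d"
        and d: "d e1 = 0" "d e2 = 0" "d ex = p *s ex + q *s ey" "d ey = r *s ex - p *s ey"
        unfolding even by blast
      show "basis_map 0 0 (\<phi> d $ 1 $ 1 *s ex + \<phi> d $ 1 $ 2 *s ey)
        (\<phi> d $ 2 $ 1 *s ex + \<phi> d $ 2 $ 2 *s ey) = d"
        \<comment> \<open>The first four occurrences of \<open>d\<close> sit inside
          \<open>\<phi> d\<close>; only the right-hand side is to be expanded.\<close>
        by (subst (5) linear_eq_basis_map[OF lin]) (simp add: d vec.scale_minus_left)
    qed
    show "\<forall>A\<in>sl2. \<phi> (basis_map 0 0 (A $ 1 $ 1 *s ex + A $ 1 $ 2 *s ey)
        (A $ 2 $ 1 *s ex + A $ 2 $ 2 *s ey)) = A"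
      by (simp add: vec_eq_iff forall_2)
    show "\<phi> ` ?L \<subseteq> sl2"
      by (auto simp: even sl2_def trace_2)
    show "(\<lambda>A. basis_map 0 0 (A $ 1 $ 1 *s ex + A $ 1 $ 2 *s ey)
        (A $ 2 $ 1 *s ex + A $ 2 $ 2 *s ey)) ` sl2 \<subseteq> ?L"
    proof clarify
      fix A :: "'f^2^2" assume "A \<in> sl2"
      then have "A $ 2 $ 2 = - A $ 1 $ 1"
        by (simp add: sl2_def trace_2 add_eq_0_iff)
      then show "basis_map 0 0 (A $ 1 $ 1 *s ex + A $ 1 $ 2 *s ey)
          (A $ 2 $ 1 *s ex + A $ 2 $ 2 *s ey) \<in> ?L"
        unfolding even using linear_basis_map by (auto simp: vec.scale_minus_left)
    qed
  qed
  have "\<phi> (commutator d d') = mat_bracket (\<phi> d) (\<phi> d')" if dd': "d \<in> ?L" "d' \<in> ?L" for d d'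
  proof -
    obtain p q r p' q' r' where lin: "Vector_Spaces.linear (*s) (*s) d" "Vector_Spaces.linear (*s) (*s) d'"
      and d: "d ex = p *s ex + q *s ey" "d ey = r *s ex - p *s ey"
        "d' ex = p' *s ex + q' *s ey" "d' ey = r' *s ex - p' *s ey"
      using dd' unfolding even by blast
    show ?thesis
      by (simp add: vec_eq_iff forall_2 commutator_def mat_bracket_def matrix_matrix_mult_def sum_2 d
          lin[THEN vec.linear_add] lin[THEN vec.linear_diff] lin[THEN vec.linear_scale] algebra_simps)
  qed
  moreover have "\<phi> (d + d') = \<phi> d + \<phi> d'" "\<phi> (map_scale k d) = mat_scale k (\<phi> d)" for d d' k
    by (simp_all add: vec_eq_iff forall_2 map_scale_def mat_scale_def)
  ultimately show ?thesis
    unfolding lie_isomorphic_def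
    using bij lie_algebra_sl2 graded_algebra.lie_algebra_Der_part_0[OF assms(2)] by blast
qed

section \<open>Dimension of the odd part\<close>

lemma map_dim_D_half_odd:
  assumes odd: "L =
     {d. Vector_Spaces.linear (*s) (*s) d \<and> (\<exists>p q :: 'f::field.
       d e1 = p *s ex + q *s ey \<and> d e2 = - (p *s ex + q *s ey) \<and>
       d ex = 2 *s ((- q) *s e1 + (q * t) *s e2) \<and> d ey = 2 *s (p *s e1 - (p * t) *s e2))}"
  shows "map_dim L = 2"
proof -
  \<comment> \<open>The derivations with parameters (p, q) = (1, 0) and (0, 1).\<close>
  define dx dy where "dx = basis_map ex (- ex) 0 (2 *s (e1 - t *s e2))"
    and "dy = basis_map ey (- ey) ((- 2) *s (e1 - t *s e2)) 0"
  have "L = map_span {dx, dy}"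
  proof (intro equalityI subsetI)
    fix d assume "d \<in> L"
    then obtain p q where lin: "Vector_Spaces.linear (*s) (*s) d"
      and d: "d e1 = p *s ex + q *s ey" "d e2 = - (p *s ex + q *s ey)"
       "d ex = 2 *s ((- q) *s e1 + (q * t) *s e2)" "d ey = 2 *s (p *s e1 - (p * t) *s e2)"
      unfolding odd by blast
    have "d - map_scale p dx = map_scale q dy"
      by (subst linear_eq_basis_map[OF lin])
        (simp add: d fun_eq_iff map_scale_def basis_map_def vec_eq_iff all_idx dx_def dy_def algebra_simps)
    then show "d \<in> map_span {dx, dy}"
      by (auto simp: map_vs.span_breakdown_eq)
  next
    fix d assume "d \<in> map_span {dx, dy}"
    then obtain p q where "d - map_scale p dx = map_scale q dy"
      by (auto simp: map_vs.span_breakdown_eq)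
    then have d: "d = map_scale p dx + map_scale q dy"
      by (simp add: algebra_simps)
    have "Vector_Spaces.linear (*s) (*s) d"
      unfolding d plus_fun_def map_scale_def dx_def dy_def
      by (intro vec.linear_compose_add vec.linear_compose_scale_right linear_basis_map)
    then show "d \<in> L"
      unfolding odd
      by (auto simp: d map_scale_def dx_def dy_def vec_eq_iff all_idx intro!: exI[of _ p] exI[of _ q])
  qed
  moreover have "map_vs.independent {dx, dy}" and "dx \<noteq> dy"
  proof -
    \<comment> \<open>Evaluation at \<open>e1\<close> sends the two maps to x and y, which already
      shows their independence.\<close>
    have nz: "dx e1 $ X = 1" "dx e1 $ Y = 0" "dy e1 $ X = 0" "dy e1 $ Y = 1"
      by (simp_all add: dx_def dy_def)
    then show "dx \<noteq> dy" by auto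
    have "dy \<noteq> 0" using nz(4) by auto
    moreover have "dx \<noteq> map_scale k dy" for k
    proof
      assume "dx = map_scale k dy"
      then have "dx e1 $ X = k * dy e1 $ X" by (simp add: map_scale_def)
      then show False by (simp add: nz)
    qed
    ultimately show "map_vs.independent {dx, dy}"
      by (auto simp: map_vs.independent_insert map_vs.span_singleton)
  qed
  ultimately show ?thesis
    using map_vs.dim_span_eq_card_independent[of "{dx, dy}"] by simp
qed

text \<open>The restrictions on the one-dimensionality claims exclude genuine exceptions. For t = -1
  every pair p, q yields an odd derivation, so the odd part is nonzero. In item (3) with 3 = 0, the
  pair p = 0, q = 1 solves the odd equations for every t.\<close>

theorem theorem10:
  fixes t \<alpha> :: "'f::field"
  assumes char_not_2: "(2::'f) \<noteq> 0"
  shows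
    "(let K = D_mult t (1/2) 0 0 in
       lie_isomorphic map_scale commutator (Der_part K D_part 0) mat_scale mat_bracket (sl2 :: ('f^2^2) set) \<and>
       Der_part K D_part 0 =
         {d. Vector_Spaces.linear (*s) (*s) d \<and> (\<exists>\<gamma>\<^sub>1 \<gamma>\<^sub>2 \<gamma>\<^sub>3.
            d e1 = 0 \<and> d e2 = 0 \<and>
            d ex = \<gamma>\<^sub>1 *s ex + \<gamma>\<^sub>2 *s ey \<and> d ey = \<gamma>\<^sub>3 *s ex - \<gamma>\<^sub>1 *s ey)} \<and>
       map_dim (Der_part K D_part 1) = 2 \<and>
       Der_part K D_part 1 =
         {d. Vector_Spaces.linear (*s) (*s) d \<and> (\<exists>\<gamma>\<^sub>1 \<gamma>\<^sub>2.
            d e1 = \<gamma>\<^sub>1 *s ex + \<gamma>\<^sub>2 *s ey \<and> d e2 = - (\<gamma>\<^sub>1 *s ex + \<gamma>\<^sub>2 *s ey) \<and>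
            d ex = 2 *s ((- \<gamma>\<^sub>2) *s e1 + (\<gamma>\<^sub>2 * t) *s e2) \<and>
            d ey = 2 *s (\<gamma>\<^sub>1 *s e1 - (\<gamma>\<^sub>1 * t) *s e2))}) \<and>
     (\<alpha> \<noteq> 1/2 \<longrightarrow> (let K = D_mult t \<alpha> 0 0 in
       (t \<noteq> - 1 \<longrightarrow> Der_one_dimensional_lie_algebra K D_part) \<and>
       Der_part K D_part 0 =
         {d. Vector_Spaces.linear (*s) (*s) d \<and> (\<exists>\<gamma>.
            d e1 = 0 \<and> d e2 = 0 \<and> d ex = \<gamma> *s ex \<and> d ey = - (\<gamma> *s ey))})) \<and>
     (let K = D_mult t (1/2) (1/2) 0 in
       (t \<noteq> - 1 \<and> (3::'f) \<noteq> 0 \<longrightarrow> Der_one_dimensional_lie_algebra K D_part) \<and>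
       Der_part K D_part 0 =
         {d. Vector_Spaces.linear (*s) (*s) d \<and> (\<exists>\<gamma>.
            d e1 = 0 \<and> d e2 = 0 \<and> d ex = \<gamma> *s ey \<and> d ey = 0)})"
proof -
  \<comment> \<open>For \<beta> = \<gamma> = 0 every nontrivial constraint, even or odd, contains
    the factor 2\<alpha> - 1, so for \<alpha> = 1/2 all parameters become free.\<close>
  have half: "2 * (1 / 2) - 1 = (0::'f)"
    using char_not_2 by simp
  have even_half: "Der_part (D_mult t (1/2) 0 0) D_part 0 =
         {d. Vector_Spaces.linear (*s) (*s) d \<and> (\<exists>p q r.
            d e1 = 0 \<and> d e2 = 0 \<and> d ex = p *s ex + q *s ey \<and> d ey = r *s ex - p *s ey)}"
    unfolding Der_part_0_eq[OF char_not_2] half by simp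
  have odd_half: "Der_part (D_mult t (1/2) 0 0) D_part 1 =
         {d. Vector_Spaces.linear (*s) (*s) d \<and> (\<exists>p q.
            d e1 = p *s ex + q *s ey \<and> d e2 = - (p *s ex + q *s ey) \<and>
            d ex = 2 *s ((- q) *s e1 + (q * t) *s e2) \<and>
            d ey = 2 *s (p *s e1 - (p * t) *s e2))}"
    unfolding Der_part_1_eq[OF char_not_2] half by simp
  have diag: "Der_part (D_mult t \<alpha> 0 0) D_part 0 =
         {d. Vector_Spaces.linear (*s) (*s) d \<and> (\<exists>k.
            d e1 = 0 \<and> d e2 = 0 \<and> d ex = k *s ex \<and> d ey = - (k *s ey))}"
    and diag_dim: "t \<noteq> - 1 \<Longrightarrow> Der_one_dimensional_lie_algebra (D_mult t \<alpha> 0 0) D_part"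
    if "\<alpha> \<noteq> 1/2"
  proof -
    \<comment> \<open>The same factor is now invertible: it forces q = r = 0 for even derivations
      and, after cancelling t + 1, p = q = 0 for odd ones.\<close>
    have nz: "2 * \<alpha> - 1 \<noteq> 0"
      using that char_not_2 by (simp add: field_simps)
    show *: "Der_part (D_mult t \<alpha> 0 0) D_part 0 =
         {d. Vector_Spaces.linear (*s) (*s) d \<and> (\<exists>k.
            d e1 = 0 \<and> d e2 = 0 \<and> d ex = k *s ex \<and> d ey = - (k *s ey))}"
      unfolding Der_part_0_eq[OF char_not_2] using nz by auto
    show "Der_one_dimensional_lie_algebra (D_mult t \<alpha> 0 0) D_part" if "t \<noteq> - 1"
    proof (rule D_one_dimensional_lie_algebraI[OF char_not_2 _ _ that, where u = ex and v = "- ey"])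
      show "ex \<noteq> (0::'f^idx) \<or> - ey \<noteq> (0::'f^idx)"
        by (simp add: vec_eq_iff all_idx)
    qed (use nz * in \<open>simp_all add: vec.scale_minus_right\<close>)
  qed
  \<comment> \<open>With \<beta> = 1/2 and \<gamma> = 0 the even constraints reduce to r = 0 and p =
    0, which leaves q as the parameter.\<close>
  have nil: "Der_part (D_mult t (1/2) (1/2) 0) D_part 0 =
         {d. Vector_Spaces.linear (*s) (*s) d \<and> (\<exists>k.
            d e1 = 0 \<and> d e2 = 0 \<and> d ex = k *s ey \<and> d ey = 0)}"
    unfolding Der_part_0_eq[OF char_not_2] half using char_not_2 by auto
  \<comment> \<open>Here the odd constraints become p/2 = 0 and 3q/2 = 0; the second is where 3 must
    be invertible.\<close>
  have "Der_one_dimensional_lie_algebra (D_mult t (1/2) (1/2) 0) D_part" if "t \<noteq> - 1" "(3::'f) \<noteq> 0"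
  proof (rule D_one_dimensional_lie_algebraI[OF char_not_2 _ _ that(1), where u = ey and v = 0])
    show "ey \<noteq> (0::'f^idx) \<or> 0 \<noteq> (0::'f^idx)"
      by (simp add: vec_eq_iff all_idx)
  qed (use char_not_2 that(2) nil half in simp_all)
  then show ?thesis
    unfolding Let_def
    using D_even_lie_isomorphic_sl2[OF even_half D.graded_algebra_axioms]
      even_half odd_half map_dim_D_half_odd[OF odd_half] diag diag_dim nil by blast
qed

end
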